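(* Let $a$ and $b$ be integers such that $2\leq a\leq 2b$, $2\leq b\leq 2a$, and $a+b\equiv 1\pmod 3$. Then the $(a,b)$-benzel has a unique stones-and-bones tiling, and this tiling consists entirely of right stones.
   Context: Let $\omega=e^{2\pi i/3}$. The hexagonal grid is the tiling of the complex plane by regular hexagons of side length $1$ (called cells) for which one of the cells is the hexagon with vertices $1\pm 1,\ 1\pm\omega,\ 1\pm\omega^2$ (so the cell centers are the points $1+m(1-\omega)+n(1-\omega^2)$ with $m,n\in\mathbb Z$). For integers $a,b$ with $2\le a\le 2b$ and $2\le b\le 2a$, the $(a,b)$-benzel is the union of the cells lying entirely within the (closed, possibly degenerate) hexagon with vertices $a\omega+b,\ -a\omega^2-b,\ a\omega^2+b\omega,\ -a-b\omega,\ a+b\omega^2,\ -a\omega-b\omega^2$. The five prototiles, each a union of three cells, are described by the centers of their cells. A right stone has centers $v+1,v+\omega,v+\omega^2$. A left stone has centers $v-1,v-\omega,v-\omega^2$. A vertical bone has centers $c-\sqrt3\,i,\ c,\ c+\sqrt3\, i$. A rising bone has centers $c-\sqrt3e^{i\pi/6},\ c,\ c+\sqrt3e^{i\pi/6}$. A falling bone has centers $c-\sqrt3e^{-i\pi/6},\ c,\ c+\sqrt3e^{-i\pi/6}$. Tiles may be translated (so that they consist of cells of the grid) but not rotated. A stones-and-bones tiling of a region (a union of cells) is a set of tiles, each of one of these five types, such that each cell of the region is in exactly one tile and every tile is contained in the region. *)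

theory Defs
  imports "HOL-Analysis.Analysis"
begin

definition omega :: complex where
  "omega = exp (2 * of_real pi * \<i> / 3)"

definition cell_centers :: "complex set" where
  "cell_centers = {1 + of_int m * (1 - omega) + of_int n * (1 - omega^2) | m n :: int. True}"

definition cell :: "complex \<Rightarrow> complex set" where
  "cell c = convex hull {c + 1, c - 1, c + omega, c - omega, c + omega^2, c - omega^2}"

definition cells :: "complex set set" where
  "cells = cell ` cell_centers"

text \<open>The six points are listed in counterclockwise order. For \<open>2 \<le> a \<le> 2 * b\<close> and
  \<open>2 \<le> b \<le> 2 * a\<close> the closed polygon through them is convex (its sides have lengths
  \<open>2 * b - a\<close> and \<open>2 * a - b\<close> alternately and it degenerates to a triangle if one of these is 0),
  so it is the convex hull of its vertices.\<close>

definition benzel_hexagon :: "int \<Rightarrow> int \<Rightarrow> complex set" where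
  "benzel_hexagon a b = convex hull
     {of_int a * omega + of_int b,
      - of_int a * omega^2 - of_int b,
      of_int a * omega^2 + of_int b * omega,
      - of_int a - of_int b * omega,
      of_int a + of_int b * omega^2,
      - of_int a * omega - of_int b * omega^2}"

definition benzel :: "int \<Rightarrow> int \<Rightarrow> complex set" where
  "benzel a b = \<Union> {C \<in> cells. C \<subseteq> benzel_hexagon a b}"

text \<open>Tiles are point sets, namely unions of three grid cells. The sets below contain all translates
  of a prototile that consist of cells of the grid.\<close>

definition tiles_of :: "(complex \<Rightarrow> complex set) \<Rightarrow> complex set set" where
  "tiles_of P = {\<Union> (cell ` P v) | v. P v \<subseteq> cell_centers}"

definition right_stones :: "complex set set" where
  "right_stones = tiles_of (\<lambda>v. {v + 1, v + omega, v + omega^2})"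

definition left_stones :: "complex set set" where
  "left_stones = tiles_of (\<lambda>v. {v - 1, v - omega, v - omega^2})"

definition vertical_bones :: "complex set set" where
  "vertical_bones = tiles_of (\<lambda>c. {c - of_real (sqrt 3) * \<i>, c, c + of_real (sqrt 3) * \<i>})"

definition rising_bones :: "complex set set" where
  "rising_bones = tiles_of (\<lambda>c. {c - of_real (sqrt 3) * exp (\<i> * of_real pi / 6), c,
                                 c + of_real (sqrt 3) * exp (\<i> * of_real pi / 6)})"

definition falling_bones :: "complex set set" where
  "falling_bones = tiles_of (\<lambda>c. {c - of_real (sqrt 3) * exp (- \<i> * of_real pi / 6), c,
                                  c + of_real (sqrt 3) * exp (- \<i> * of_real pi / 6)})"

definition stones_and_bones :: "complex set set" where
  "stones_and_bones = right_stones \<union> left_stones \<union> vertical_bones \<union> rising_bones \<union> falling_bones"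

definition stones_and_bones_tiling :: "complex set \<Rightarrow> complex set set \<Rightarrow> bool" where
  "stones_and_bones_tiling R T \<longleftrightarrow>
     T \<subseteq> stones_and_bones \<and>
     (\<forall>t\<in>T. t \<subseteq> R) \<and>
     (\<forall>C\<in>cells. C \<subseteq> R \<longrightarrow> (\<exists>!t. t \<in> T \<and> C \<subseteq> t))"

end

theory Submission
  imports Defs
begin

text \<open>
  The proof is a linear programming certificate: a weight on the cells under which every tile has
  nonpositive total, and total 0 exactly when it is a right stone in one particular class.

  Index the cells by integer pairs \<open>(m, n)\<close> through their centers
  \<open>1 + m (1 - \<omega>) + n (1 - \<omega>\<^sup>2)\<close>, and color the cell \<open>(m, n)\<close> by \<open>m - n - s\<close> modulo 3, where \<open>s\<close> is a
  parameter. The three vectors \<open>u\<^sub>1 = (1, 0)\<close>, \<open>u\<^sub>2 = (0, -1)\<close>, \<open>u\<^sub>3 = (-1, 1)\<close> have sum 0, and each of them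
  raises the color by 1. Hence every tile has one cell of each color. Let \<open>x\<close>, \<open>y\<close>, \<open>z\<close> be the
  displacements between its cells from color 2 to 0, from 0 to 1 and from 1 to 2. Then \<open>(x, y, z)\<close> is
  an even permutation of \<open>(u\<^sub>1, u\<^sub>2, u\<^sub>3)\<close> for a right stone, an odd one for a left stone, and a
  rearrangement of \<open>(u\<^sub>i, u\<^sub>i, - 2 u\<^sub>i)\<close> for a bone. With the symmetric bilinear form given by
  \<open>\<langle>u\<^sub>i, u\<^sub>i\<rangle> = 2\<close> and \<open>\<langle>u\<^sub>i, u\<^sub>j\<rangle> = -1\<close>, the number
  \<open>\<langle>u\<^sub>1, x\<rangle> + \<langle>u\<^sub>2, y\<rangle> + \<langle>u\<^sub>3, z\<rangle>\<close> is 6 if \<open>(x, y, z) = (u\<^sub>1, u\<^sub>2, u\<^sub>3)\<close>, that is, for a right stone whose cell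
  \<open>v + 1\<close> has color 0 (an aligned stone), and at most 3 for all other tiles. This number is a sum
  of contributions of the single cells, because it is linear in their positions; lowering each
  contribution by 2 gives the weight.

  Now let a finite region be tiled by aligned stones. The total weight of its cells is 0, so in any
  other tiling all tiles have total 0 and are aligned as well. Each cell lies in only one aligned
  stone, so the two tilings agree (\<open>aligned_tiling_unique\<close>).

  It remains to see that the benzel is a union of aligned stones (\<open>aligned_stone_in_benzel\<close>). For
  \<open>z = x + y \<omega>\<close> the hexagon is given by bounds \<open>- b\<close> and \<open>a\<close> on the three quantities \<open>y\<close>, \<open>- x\<close> and
  \<open>x - y\<close>. At the vertex that a right stone surrounds, all three are congruent modulo 3. When
  \<open>a + b\<close> is 1 modulo 3, the choice \<open>s = b + 1\<close> makes this residue avoid \<open>- b\<close>, \<open>1 - b\<close>, \<open>a - 1\<close> and \<open>a\<close>, the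
  only values at which the hexagon could contain some but not all cells of the stone.
\<close>

section \<open>The grid in integer coordinates\<close>

lemma omega_eq: "omega = Complex (-1/2) (sqrt 3 / 2)"
proof -
  have "omega = cis (2 * pi / 3)"
    by (simp add: omega_def cis_conv_exp mult.commute)
  also have "\<dots> = Complex (-1/2) (sqrt 3 / 2)"
    by (simp add: complex_eq_iff cos_120 sin_120)
  finally show ?thesis .
qed

lemma omega_squared: "omega\<^sup>2 = - 1 - omega"
  by (simp add: omega_eq complex_eq_iff power2_eq_square)

definition center :: "int \<times> int \<Rightarrow> complex" where
  "center p = 1 + of_int (fst p) * (1 - omega) + of_int (snd p) * (1 - omega\<^sup>2)"

definition grid_cell :: "int \<times> int \<Rightarrow> complex set" where
  "grid_cell p = cell (center p)"

definition patch :: "(int \<times> int) set \<Rightarrow> complex set" where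
  "patch Q = \<Union> (grid_cell ` Q)"

definition indices :: "complex set \<Rightarrow> (int \<times> int) set" where
  "indices R = {p. grid_cell p \<subseteq> R}"

lemma cell_centers_eq: "cell_centers = range center"
  by (auto simp: cell_centers_def center_def image_iff split_paired_Ex) blast+

lemma cells_eq: "cells = range grid_cell"
  by (auto simp: cells_def cell_centers_eq grid_cell_def)

lemma center_in_grid_cell: "center p \<in> grid_cell p"
proof -
  let ?c = "center p"
  have "(1/2) *\<^sub>R (?c + 1) + (1/2) *\<^sub>R (?c - 1) \<in> cell ?c"
    unfolding cell_def
    by (rule convexD[OF convex_convex_hull]) (auto intro: hull_inc)
  moreover have "(1/2) *\<^sub>R (?c + 1) + (1/2) *\<^sub>R (?c - 1) = ?c"
    by (simp add: complex_eq_iff field_simps)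
  ultimately show ?thesis by (simp add: grid_cell_def)
qed

lemma cell_subset_cball: "cell c \<subseteq> cball c 1"
proof -
  have "norm omega = 1"
    by (simp add: omega_def norm_exp_eq_Re)
  then have "norm (omega\<^sup>2) = 1" by (simp add: norm_power)
  with \<open>norm omega = 1\<close> show ?thesis
    unfolding cell_def by (intro hull_minimal) (auto simp: dist_norm)
qed

lemma norm_center_diff:
  "(norm (center (m, n) - center (m', n')))\<^sup>2
    = of_int (3 * ((m - m')\<^sup>2 + (m - m') * (n - n') + (n - n')\<^sup>2))"
proof -
  define u v where "u = real_of_int (m - m')" and "v = real_of_int (n - n')"
  have "center (m, n) - center (m', n') = Complex (3/2 * (u + v)) (sqrt 3 / 2 * (v - u))"
    unfolding center_def omega_squared u_def v_def
    by (simp add: omega_eq complex_eq_iff field_simps)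
  moreover have "(norm (Complex (3/2 * (u + v)) (sqrt 3 / 2 * (v - u))))\<^sup>2
      = 3 * (u\<^sup>2 + u * v + v\<^sup>2)"
    by (simp add: cmod_power2 power_mult_distrib power_divide)
       (simp add: power2_eq_square field_simps)
  ultimately show ?thesis by (simp add: u_def v_def)
qed

text \<open>Membership of its center identifies a cell: distinct centers are at distance at least
  \<open>sqrt 3\<close>, while a cell reaches only distance 1 from its own center.\<close>
lemma center_in_grid_cell_iff: "center p \<in> grid_cell q \<longleftrightarrow> p = q"
proof
  assume "center p \<in> grid_cell q"
  then have "norm (center p - center q) \<le> 1"
    using cell_subset_cball by (force simp: grid_cell_def dist_norm norm_minus_commute)
  then have le: "(norm (center p - center q))\<^sup>2 \<le> 1"
    by (simp add: power_le_one)
  obtain m n m' n' where pq: "p = (m, n)" "q = (m', n')"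
    by (cases p, cases q)
  define x y where "x = m - m'" and "y = n - n'"
  define N where "N = x\<^sup>2 + x * y + y\<^sup>2"
  have "3 * N \<le> 1"
    using le unfolding pq norm_center_diff N_def x_def y_def of_int_le_1_iff .
  then have "N \<le> 0" by simp
  moreover have "x\<^sup>2 + y\<^sup>2 + (x + y)\<^sup>2 = 2 * N"
    by (simp add: N_def power2_eq_square algebra_simps)
  ultimately have "x\<^sup>2 + y\<^sup>2 \<le> 0"
    using zero_le_power2[of "x + y"] by linarith
  then show "p = q"
    by (simp add: pq x_def y_def sum_power2_le_zero_iff)
qed (simp add: center_in_grid_cell)

text \<open>A union of cells contains no further grid cell, so inclusions between tiles, cells and regions
  may be computed on integer pairs.\<close>
lemma indices_patch [simp]: "indices (patch Q) = Q"
proof -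
  have "p \<in> Q" if "grid_cell p \<subseteq> patch Q" for p
  proof -
    have "center p \<in> patch Q" using that center_in_grid_cell by blast
    then show ?thesis by (simp add: patch_def center_in_grid_cell_iff)
  qed
  then show ?thesis by (auto simp: indices_def patch_def)
qed

section \<open>The tiles in integer coordinates\<close>

definition right_shape :: "int \<times> int \<Rightarrow> (int \<times> int) set" where
  "right_shape = (\<lambda>(m, n). {(m, n), (m - 1, n), (m, n - 1)})"

definition left_shape :: "int \<times> int \<Rightarrow> (int \<times> int) set" where
  "left_shape = (\<lambda>(m, n). {(m, n), (m + 1, n), (m, n + 1)})"

definition vertical_shape :: "int \<times> int \<Rightarrow> (int \<times> int) set" where
  "vertical_shape = (\<lambda>(m, n). {(m + 1, n - 1), (m, n), (m - 1, n + 1)})"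

definition rising_shape :: "int \<times> int \<Rightarrow> (int \<times> int) set" where
  "rising_shape = (\<lambda>(m, n). {(m, n - 1), (m, n), (m, n + 1)})"

definition falling_shape :: "int \<times> int \<Rightarrow> (int \<times> int) set" where
  "falling_shape = (\<lambda>(m, n). {(m - 1, n), (m, n), (m + 1, n)})"

text \<open>The prototile position \<open>v\<close> need not itself be a center; the offset \<open>d\<close> leads from it to the center
  of a cell of the tile, which then serves as anchor.\<close>
lemma tiles_of_eq_patches:
  assumes "\<And>v. v + d \<in> P v"
    and "\<And>p. P (center p - d) = center ` Q p"
  shows "tiles_of P = range (\<lambda>p. patch (Q p))"
proof -
  have cell_image: "\<Union> (cell ` P (center p - d)) = patch (Q p)" for p
    by (simp add: assms(2) patch_def grid_cell_def image_image)
  show ?thesis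
  proof
    show "tiles_of P \<subseteq> range (\<lambda>p. patch (Q p))"
    proof
      fix t assume "t \<in> tiles_of P"
      then obtain v where v: "t = \<Union> (cell ` P v)" "P v \<subseteq> range center"
        by (auto simp: tiles_of_def cell_centers_eq)
      then obtain p where "v + d = center p" using assms(1)[of v] by blast
      then have "v = center p - d" by (simp add: eq_diff_eq)
      with v(1) cell_image[of p] show "t \<in> range (\<lambda>p. patch (Q p))" by blast
    qed
  next
    show "range (\<lambda>p. patch (Q p)) \<subseteq> tiles_of P"
    proof
      fix t assume "t \<in> range (\<lambda>p. patch (Q p))"
      then obtain p where "t = \<Union> (cell ` P (center p - d))" using cell_image by auto
      moreover have "P (center p - d) \<subseteq> range center" by (auto simp: assms(2))
      ultimately show "t \<in> tiles_of P" by (auto simp: tiles_of_def cell_centers_eq)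
    qed
  qed
qed

lemma vertical_step: "of_real (sqrt 3) * \<i> = omega - omega\<^sup>2"
  unfolding omega_squared by (simp add: omega_eq complex_eq_iff)

lemma rising_step: "of_real (sqrt 3) * exp (\<i> * of_real pi / 6) = 1 - omega\<^sup>2"
proof -
  have "exp (\<i> * of_real pi / 6) = cis (pi / 6)" by (simp add: cis_conv_exp)
  then have "of_real (sqrt 3) * exp (\<i> * of_real pi / 6) = of_real (sqrt 3) * cis (pi / 6)"
    by (simp only:)
  also have "\<dots> = 1 - omega\<^sup>2"
    unfolding omega_squared by (simp add: omega_eq complex_eq_iff cos_30 sin_30)
  finally show ?thesis .
qed

lemma falling_step: "of_real (sqrt 3) * exp (- \<i> * of_real pi / 6) = 1 - omega"
proof -
  have "exp (- \<i> * of_real pi / 6) = cis (- (pi / 6))" by (simp add: cis_conv_exp)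
  then have "of_real (sqrt 3) * exp (- \<i> * of_real pi / 6) = of_real (sqrt 3) * cis (- (pi / 6))"
    by (simp only:)
  also have "\<dots> = 1 - omega"
    by (simp add: omega_eq complex_eq_iff cos_30 sin_30)
  finally show ?thesis .
qed

lemma right_stones_eq: "right_stones = range (\<lambda>p. patch (right_shape p))"
  unfolding right_stones_def
  by (rule tiles_of_eq_patches[where d = 1])
     (auto simp: right_shape_def center_def algebra_simps split: prod.splits)

lemma left_stones_eq: "left_stones = range (\<lambda>p. patch (left_shape p))"
  unfolding left_stones_def
  by (rule tiles_of_eq_patches[where d = "-1"])
     (auto simp: left_shape_def center_def algebra_simps split: prod.splits)

lemma vertical_bones_eq: "vertical_bones = range (\<lambda>p. patch (vertical_shape p))"
  unfolding vertical_bones_def vertical_step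
  by (rule tiles_of_eq_patches[where d = 0])
     (auto simp: vertical_shape_def center_def algebra_simps split: prod.splits)

lemma rising_bones_eq: "rising_bones = range (\<lambda>p. patch (rising_shape p))"
  unfolding rising_bones_def rising_step
  by (rule tiles_of_eq_patches[where d = 0])
     (auto simp: rising_shape_def center_def algebra_simps split: prod.splits)

lemma falling_bones_eq: "falling_bones = range (\<lambda>p. patch (falling_shape p))"
  unfolding falling_bones_def falling_step
  by (rule tiles_of_eq_patches[where d = 0])
     (auto simp: falling_shape_def center_def algebra_simps split: prod.splits)

section \<open>A weight that singles out one class of right stones\<close>

text \<open>The anchor \<open>(m, n)\<close> is the cell \<open>v + 1\<close> of the stone around the grid vertex \<open>v\<close>.\<close>
definition aligned_stones :: "int \<Rightarrow> complex set set" where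
  "aligned_stones s = {patch (right_shape (m, n)) | m n. (m - n - s) mod 3 = 0}"

text \<open>In terms of the bilinear form, the cell \<open>p\<close> has weight \<open>\<langle>u\<^sub>1 - u\<^sub>2, p\<rangle> - 2\<close>, \<open>\<langle>u\<^sub>2 - u\<^sub>3, p\<rangle> - 2\<close> or
  \<open>\<langle>u\<^sub>3 - u\<^sub>1, p\<rangle> - 2\<close> when its color is 0, 1 or 2.\<close>
definition weight :: "int \<Rightarrow> int \<times> int \<Rightarrow> int" where
  "weight s = (\<lambda>(m, n).
     (if (m - n - s) mod 3 = 0 then 3 * (m + n)
      else if (m - n - s) mod 3 = 1 then - 3 * n
      else - 3 * m) - 2)"

lemma weight_shift:
  fixes m n i j s :: int
  shows "weight s (m + i, n + j) =
    (let q = ((m - n - s) mod 3 + i - j) mod 3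
     in (if q = 0 then 3 * (m + n + i + j) else if q = 1 then - 3 * (n + j) else - 3 * (m + i)) - 2)"
proof -
  have "((m - n - s) mod 3 + (i - j)) mod 3 = (m - n - s + (i - j)) mod 3"
    by (rule mod_add_left_eq)
  then have "((m - n - s) mod 3 + i - j) mod 3 = (m + i - (n + j) - s) mod 3"
    by (simp add: algebra_simps)
  then show ?thesis by (simp add: weight_def Let_def)
qed

text \<open>The position of the tile cancels from each sum, because the three coefficient vectors add up to
  0; this leaves one constant for each shape and each color of its anchor.\<close>
lemma weight_shape:
  fixes m n s :: int
  shows "(m - n - s) mod 3 = 0 \<Longrightarrow> sum (weight s) (right_shape (m, n)) = 0"
    and "(m - n - s) mod 3 \<noteq> 0 \<Longrightarrow> sum (weight s) (right_shape (m, n)) < 0"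
    and "sum (weight s) (left_shape (m, n)) < 0"
    and "sum (weight s) (vertical_shape (m, n)) < 0"
    and "sum (weight s) (rising_shape (m, n)) < 0"
    and "sum (weight s) (falling_shape (m, n)) < 0"
proof -
  have r: "(m - n - s) mod 3 = 0 \<or> (m - n - s) mod 3 = 1 \<or> (m - n - s) mod 3 = 2"
    by presburger
  note w = weight_shift[of s m 0 n 0, simplified] weight_shift[of s m 0 n 1, simplified]
    weight_shift[of s m 0 n "-1", simplified] weight_shift[of s m 1 n 0, simplified]
    weight_shift[of s m "-1" n 0, simplified] weight_shift[of s m "-1" n 1, simplified]
    weight_shift[of s m 1 n "-1", simplified]
  show "(m - n - s) mod 3 = 0 \<Longrightarrow> sum (weight s) (right_shape (m, n)) = 0"
    by (simp add: right_shape_def w)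
  show "(m - n - s) mod 3 \<noteq> 0 \<Longrightarrow> sum (weight s) (right_shape (m, n)) < 0"
    using r by (elim disjE) (simp_all add: right_shape_def w)
  show "sum (weight s) (left_shape (m, n)) < 0"
    using r by (elim disjE) (simp_all add: left_shape_def w)
  show "sum (weight s) (vertical_shape (m, n)) < 0"
    using r by (elim disjE) (simp_all add: vertical_shape_def w)
  show "sum (weight s) (rising_shape (m, n)) < 0"
    using r by (elim disjE) (simp_all add: rising_shape_def w)
  show "sum (weight s) (falling_shape (m, n)) < 0"
    using r by (elim disjE) (simp_all add: falling_shape_def w)
qed

lemma aligned_stonesI:
  "(m - n - s) mod 3 = 0 \<Longrightarrow> patch (right_shape (m, n)) \<in> aligned_stones s"
  unfolding aligned_stones_def
  by (rule CollectI, rule exI[of _ m], rule exI[of _ n], rule conjI, rule refl)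

lemma aligned_subset_right: "aligned_stones s \<subseteq> right_stones"
  by (auto simp: aligned_stones_def right_stones_eq)

lemma right_stones_subset: "right_stones \<subseteq> stones_and_bones"
  by (auto simp: stones_and_bones_def)

lemma weight_tile:
  assumes "t \<in> stones_and_bones"
  shows "t \<in> aligned_stones s \<Longrightarrow> sum (weight s) (indices t) = 0"
    and "t \<notin> aligned_stones s \<Longrightarrow> sum (weight s) (indices t) < 0"
proof -
  show "t \<in> aligned_stones s \<Longrightarrow> sum (weight s) (indices t) = 0"
    by (auto simp: aligned_stones_def weight_shape)
  assume not_aligned: "t \<notin> aligned_stones s"
  obtain m n where "t \<in> {patch (right_shape (m, n)), patch (left_shape (m, n)),
      patch (vertical_shape (m, n)), patch (rising_shape (m, n)), patch (falling_shape (m, n))}"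
    using assms
    unfolding stones_and_bones_def right_stones_eq left_stones_eq vertical_bones_eq
      rising_bones_eq falling_bones_eq by fast
  then consider "t = patch (right_shape (m, n))" "(m - n - s) mod 3 \<noteq> 0"
    | "t = patch (left_shape (m, n))" | "t = patch (vertical_shape (m, n))"
    | "t = patch (rising_shape (m, n))" | "t = patch (falling_shape (m, n))"
    using not_aligned by (auto simp: aligned_stones_def)
  then show "sum (weight s) (indices t) < 0"
    by cases (auto simp: weight_shape)
qed

lemma tile_is_patch:
  assumes "t \<in> stones_and_bones"
  shows "t = patch (indices t)"
  using assms
  unfolding stones_and_bones_def right_stones_eq left_stones_eq vertical_bones_eq
    rising_bones_eq falling_bones_eq by fastforce

lemma right_shape_iff:
  "q \<in> right_shape p \<longleftrightarrow> p = q \<or> p = (fst q + 1, snd q) \<or> p = (fst q, snd q + 1)"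
  by (cases p; cases q) (auto simp: right_shape_def)

text \<open>The color of a cell decides which of the three positions it has in an aligned stone.\<close>
lemma aligned_stones_tile_plane:
  "\<exists>!t. t \<in> aligned_stones s \<and> q \<in> indices t"
proof -
  obtain m n where q: "q = (m, n)" by (cases q)
  have "\<exists>!p. (fst p - snd p - s) mod 3 = 0 \<and> q \<in> right_shape p"
  proof -
    have "(m - n - s) mod 3 = 0 \<or> (m + 1 - n - s) mod 3 = 0 \<or> (m - (n + 1) - s) mod 3 = 0"
      by presburger
    then consider "(m - n - s) mod 3 = 0" | "(m + 1 - n - s) mod 3 = 0"
      | "(m - (n + 1) - s) mod 3 = 0"
      by blast
    then show ?thesis
    proof cases
      case 1
      then have "(m + 1 - n - s) mod 3 \<noteq> 0" "(m - (n + 1) - s) mod 3 \<noteq> 0" by presburger+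
      with 1 show ?thesis unfolding right_shape_iff q by (intro ex1I[of _ "(m, n)"]) auto
    next
      case 2
      then have "(m - n - s) mod 3 \<noteq> 0" "(m - (n + 1) - s) mod 3 \<noteq> 0" by presburger+
      with 2 show ?thesis unfolding right_shape_iff q by (intro ex1I[of _ "(m + 1, n)"]) auto
    next
      case 3
      then have "(m + 1 - n - s) mod 3 \<noteq> 0" "(m - n - s) mod 3 \<noteq> 0" by presburger+
      with 3 show ?thesis unfolding right_shape_iff q by (intro ex1I[of _ "(m, n + 1)"]) auto
    qed
  qed
  then obtain p where p: "(fst p - snd p - s) mod 3 = 0" "q \<in> right_shape p"
    and unique: "\<forall>p'. (fst p' - snd p' - s) mod 3 = 0 \<and> q \<in> right_shape p' \<longrightarrow> p' = p"
    by (elim ex1E conjE) (rule that, assumption+)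
  show ?thesis
  proof (rule ex1I[of _ "patch (right_shape p)"])
    show "patch (right_shape p) \<in> aligned_stones s \<and> q \<in> indices (patch (right_shape p))"
      using p aligned_stonesI[of "fst p" "snd p" s] by simp
  next
    fix t assume "t \<in> aligned_stones s \<and> q \<in> indices t"
    then show "t = patch (right_shape p)"
      using unique by (force simp: aligned_stones_def)
  qed
qed

section \<open>Uniqueness\<close>

lemma tiling_iff_indices:
  "stones_and_bones_tiling R T \<longleftrightarrow>
     T \<subseteq> stones_and_bones \<and> (\<forall>t\<in>T. t \<subseteq> R) \<and>
     (\<forall>p\<in>indices R. \<exists>!t. t \<in> T \<and> p \<in> indices t)"
  by (simp add: stones_and_bones_tiling_def cells_eq indices_def)

lemma finite_tiling:
  assumes "finite (indices R)" "stones_and_bones_tiling R T"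
  shows "finite T"
proof (rule finite_subset)
  show "T \<subseteq> patch ` Pow (indices R)"
  proof
    fix t assume "t \<in> T"
    then have t: "t \<in> stones_and_bones" "t \<subseteq> R"
      using assms(2) by (auto simp: tiling_iff_indices)
    have "t = patch (indices t)" using t(1) by (rule tile_is_patch)
    moreover have "indices t \<subseteq> indices R" using t(2) by (auto simp: indices_def)
    ultimately show "t \<in> patch ` Pow (indices R)" by blast
  qed
qed (use assms(1) in simp)

lemma sum_over_tiling:
  fixes w :: "int \<times> int \<Rightarrow> int"
  assumes fin: "finite (indices R)" and T: "stones_and_bones_tiling R T"
  shows "sum w (indices R) = (\<Sum>t\<in>T. sum w (indices t))"
proof -
  have sub: "indices t \<subseteq> indices R" if "t \<in> T" for t
    using T that by (force simp: tiling_iff_indices indices_def)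
  then have "(\<Union>t\<in>T. indices t) = indices R"
    using T unfolding tiling_iff_indices by blast
  moreover have "sum w (\<Union>t\<in>T. indices t) = (\<Sum>t\<in>T. sum w (indices t))"
  proof (rule sum.UNION_disjoint)
    show "finite T" using fin T by (rule finite_tiling)
    show "\<forall>t\<in>T. finite (indices t)" using sub fin finite_subset by blast
    show "\<forall>t\<in>T. \<forall>u\<in>T. t \<noteq> u \<longrightarrow> indices t \<inter> indices u = {}"
      using T sub unfolding tiling_iff_indices by blast
  qed
  ultimately show ?thesis by simp
qed

text \<open>Both tilings have the same total weight, namely that of the region. It is 0 for the aligned
  tiling, and a tile that is not aligned would make it negative.\<close>
lemma aligned_tiling_unique:
  fixes R s
  defines "T0 \<equiv> {t \<in> aligned_stones s. t \<subseteq> R}"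
  assumes fin: "finite (indices R)"
    and T0: "stones_and_bones_tiling R T0"
    and T: "stones_and_bones_tiling R T"
  shows "T = T0"
proof -
  let ?w = "\<lambda>t. sum (weight s) (indices t)"
  have tiles: "T \<subseteq> stones_and_bones" "T0 \<subseteq> stones_and_bones"
    using T T0 by (auto simp: tiling_iff_indices)
  have "(\<Sum>t\<in>T. ?w t) = (\<Sum>t\<in>T0. ?w t)"
    using sum_over_tiling[OF fin T] sum_over_tiling[OF fin T0] by metis
  also have "\<dots> = 0"
    using tiles(2) weight_tile(1) by (intro sum.neutral) (auto simp: T0_def)
  finally have "(\<Sum>t\<in>T. - ?w t) = 0"
    by (simp add: sum_negf)
  moreover have "0 \<le> - ?w t" if "t \<in> T" for t
    using that tiles(1) weight_tile[of t s] by (cases "t \<in> aligned_stones s") force+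
  ultimately have "\<forall>t\<in>T. - ?w t = 0"
    using finite_tiling[OF fin T] sum_nonneg_eq_0_iff[of T "\<lambda>t. - ?w t"] by blast
  then have "T \<subseteq> aligned_stones s"
    using tiles(1) weight_tile(2)[of _ s] by force
  then have sub: "T \<subseteq> T0"
    using T by (auto simp: T0_def tiling_iff_indices)
  moreover have "T0 \<subseteq> T"
  proof
    fix t assume t: "t \<in> T0"
    then obtain q where q: "q \<in> indices t"
      by (force simp: T0_def aligned_stones_def right_shape_def)
    then have "q \<in> indices R" using t by (auto simp: T0_def indices_def)
    then obtain u where "u \<in> T" "q \<in> indices u"
      using T unfolding tiling_iff_indices by blast
    then show "t \<in> T"
      using t q sub aligned_stones_tile_plane[of s q] by (auto simp: T0_def)
  qed
  ultimately show ?thesis by blast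
qed

section \<open>The cells of a benzel\<close>

definition lattice_point :: "real \<Rightarrow> real \<Rightarrow> complex" where
  "lattice_point x y = of_real x + of_real y * omega"

lemma lattice_point_eq_iff [simp]:
  "lattice_point x y = lattice_point x' y' \<longleftrightarrow> x = x' \<and> y = y'"
  by (auto simp: lattice_point_def omega_eq complex_eq_iff)

lemma center_eq_lattice_point:
  "center (m, n) = lattice_point (of_int (1 + m + 2 * n)) (of_int (n - m))"
  by (simp add: center_def lattice_point_def omega_squared algebra_simps)

lemma lattice_point_on_segment:
  assumes "convex S" "lattice_point x y \<in> S" "lattice_point (x + d * p) (y + d * q) \<in> S"
    and "0 \<le> r" "r \<le> d"
  shows "lattice_point (x + r * p) (y + r * q) \<in> S"
proof (cases "d = 0")
  case True
  then show ?thesis using assms by simp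
next
  case False
  define u where "u = r / d"
  have u: "0 \<le> u" "u \<le> 1" "u * d = r" using False assms(4,5) by (auto simp: u_def)
  have "(1 - u) *\<^sub>R lattice_point x y + u *\<^sub>R lattice_point (x + d * p) (y + d * q) \<in> S"
    using assms(1-3) u(1,2) by (rule convexD_alt)
  also have "(1 - u) *\<^sub>R lattice_point x y + u *\<^sub>R lattice_point (x + d * p) (y + d * q)
      = lattice_point (x + u * d * p) (y + u * d * q)"
    by (simp add: lattice_point_def scaleR_conv_of_real algebra_simps)
  finally show ?thesis by (simp only: u(3))
qed

lemma benzel_hexagon_eq_hull:
  fixes a b :: int
  defines "\<alpha> \<equiv> real_of_int a" and "\<beta> \<equiv> real_of_int b"
  shows "benzel_hexagon a b = convex hull
    {lattice_point \<beta> \<alpha>, lattice_point (\<alpha> - \<beta>) \<alpha>, lattice_point (- \<alpha>) (\<beta> - \<alpha>),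
     lattice_point (- \<alpha>) (- \<beta>), lattice_point (\<alpha> - \<beta>) (- \<beta>), lattice_point \<beta> (\<beta> - \<alpha>)}"
  unfolding benzel_hexagon_def \<alpha>_def \<beta>_def lattice_point_def omega_squared
  by (simp add: algebra_simps)

text \<open>Necessity of the bounds holds because they define a convex set that contains the vertices. For
  sufficiency, cut the hexagon by the line of constant \<open>y\<close> through the point: its ends lie on
  the sides that leave the middle pair of vertices, at level \<open>b - a\<close>, upwards or downwards.\<close>
lemma lattice_point_in_hexagon:
  fixes a b x y :: int
  assumes ab: "a \<le> 2 * b" "b \<le> 2 * a"
  shows "lattice_point (of_int x) (of_int y) \<in> benzel_hexagon a b \<longleftrightarrow>
    - b \<le> y \<and> y \<le> a \<and> - a \<le> x \<and> x \<le> b \<and> - b \<le> x - y \<and> x - y \<le> a"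
proof -
  define \<alpha> \<beta> where "\<alpha> = real_of_int a" and "\<beta> = real_of_int b"
  have real_ab: "\<alpha> \<le> 2 * \<beta>" "\<beta> \<le> 2 * \<alpha>" using ab unfolding \<alpha>_def \<beta>_def by linarith+
  let ?H = "benzel_hexagon a b"
  let ?bounds = "\<lambda>x y. - \<beta> \<le> y \<and> y \<le> \<alpha> \<and> - \<alpha> \<le> x \<and> x \<le> \<beta> \<and> - \<beta> \<le> x - y \<and> x - y \<le> \<alpha>"
  let ?L = "\<lambda>v. lattice_point (fst v) (snd v)"
  let ?B = "{v. ?bounds (fst v) (snd v)}"
  note hull = benzel_hexagon_eq_hull[of a b, folded \<alpha>_def \<beta>_def]
  have convex: "convex ?H" by (simp add: benzel_hexagon_def)
  have vertices: "lattice_point \<beta> \<alpha> \<in> ?H" "lattice_point (\<alpha> - \<beta>) \<alpha> \<in> ?H"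
    "lattice_point (- \<alpha>) (\<beta> - \<alpha>) \<in> ?H" "lattice_point (- \<alpha>) (- \<beta>) \<in> ?H"
    "lattice_point (\<alpha> - \<beta>) (- \<beta>) \<in> ?H" "lattice_point \<beta> (\<beta> - \<alpha>) \<in> ?H"
    unfolding hull by (auto intro: hull_inc)
  have "?bounds x y" if "lattice_point x y \<in> ?H" for x y
  proof -
    have "?B = {v. (0, 1) \<bullet> v \<le> \<alpha>} \<inter> {v. (0, 1) \<bullet> v \<ge> - \<beta>} \<inter> {v. (1, 0) \<bullet> v \<le> \<beta>}
        \<inter> {v. (1, 0) \<bullet> v \<ge> - \<alpha>} \<inter> {v. (1, -1) \<bullet> v \<le> \<alpha>} \<inter> {v. (1, -1) \<bullet> v \<ge> - \<beta>}"
      by auto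
    then have "convex ?B"
      by (simp only:) (intro convex_Int convex_halfspace_le convex_halfspace_ge)
    moreover have "linear ?L"
      by (intro linearI) (simp_all add: lattice_point_def scaleR_conv_of_real algebra_simps)
    ultimately have "convex (?L ` ?B)" by (simp only: convex_linear_image)
    moreover have "lattice_point x' y' \<in> ?L ` ?B" if "?bounds x' y'" for x' y'
      using that by (intro image_eqI[of _ _ "(x', y')"]) auto
    ultimately have "?H \<subseteq> ?L ` ?B"
      unfolding hull using real_ab by (intro hull_minimal) auto
    then show ?thesis using that by auto
  qed
  moreover have "lattice_point x y \<in> ?H" if bounds: "?bounds x y" for x y
  proof (cases "\<beta> - \<alpha> \<le> y")
    case True
    have right: "lattice_point \<beta> y \<in> ?H"
      using lattice_point_on_segment[OF convex, of \<beta> "\<beta> - \<alpha>" "2 * \<alpha> - \<beta>" 0 1 "y - (\<beta> - \<alpha>)"]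
        vertices bounds True by simp
    have left: "lattice_point (y - \<beta>) y \<in> ?H"
      using lattice_point_on_segment[OF convex, of "- \<alpha>" "\<beta> - \<alpha>" "2 * \<alpha> - \<beta>" 1 1 "y - (\<beta> - \<alpha>)"]
        vertices bounds True by simp
    show ?thesis
      using lattice_point_on_segment[OF convex left, of "2 * \<beta> - y" 1 0 "x - (y - \<beta>)"]
        right bounds by simp
  next
    case False
    have left: "lattice_point (- \<alpha>) y \<in> ?H"
      using lattice_point_on_segment[OF convex, of "- \<alpha>" "- \<beta>" "2 * \<beta> - \<alpha>" 0 1 "y + \<beta>"]
        vertices bounds False by simp
    have right: "lattice_point (y + \<alpha>) y \<in> ?H"
      using lattice_point_on_segment[OF convex, of "\<alpha> - \<beta>" "- \<beta>" "2 * \<beta> - \<alpha>" 1 1 "y + \<beta>"]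
        vertices bounds False by (simp add: algebra_simps)
    show ?thesis
      using lattice_point_on_segment[OF convex left, of "y + 2 * \<alpha>" 1 0 "x + \<alpha>"]
        right bounds by (simp add: algebra_simps)
  qed
  ultimately have "lattice_point x y \<in> ?H \<longleftrightarrow> ?bounds x y" for x y by blast
  then show ?thesis
    unfolding \<alpha>_def \<beta>_def by (simp flip: of_int_minus of_int_diff)
qed

lemma cell_lattice_point:
  "cell (lattice_point (of_int x) (of_int y)) = convex hull
    ((\<lambda>(i, j). lattice_point (of_int i) (of_int j)) `
      {(x + 1, y), (x - 1, y), (x, y + 1), (x, y - 1), (x - 1, y - 1), (x + 1, y + 1)})"
  unfolding cell_def lattice_point_def omega_squared by (simp add: algebra_simps)

text \<open>Containing a cell amounts to containing its six vertices, which tightens each bound of the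
  hexagon by 1 at the center.\<close>
lemma indices_benzel:
  fixes a b :: int
  assumes ab: "a \<le> 2 * b" "b \<le> 2 * a"
  shows "indices (benzel a b) =
    {(m, n). 1 - b \<le> n - m \<and> n - m \<le> a - 1 \<and> 1 - a \<le> 1 + m + 2 * n \<and> 1 + m + 2 * n \<le> b - 1
      \<and> 1 - b \<le> 1 + 2 * m + n \<and> 1 + 2 * m + n \<le> a - 1}"
proof -
  have in_benzel: "grid_cell p \<subseteq> benzel a b \<longleftrightarrow> grid_cell p \<subseteq> benzel_hexagon a b" for p
    by (auto simp: benzel_def cells_eq)
  have in_hexagon: "grid_cell (m, n) \<subseteq> benzel_hexagon a b \<longleftrightarrow>
      1 - b \<le> n - m \<and> n - m \<le> a - 1 \<and> 1 - a \<le> 1 + m + 2 * n \<and> 1 + m + 2 * n \<le> b - 1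
      \<and> 1 - b \<le> 1 + 2 * m + n \<and> 1 + 2 * m + n \<le> a - 1" for m n
  proof -
    define x y where "x = 1 + m + 2 * n" and "y = n - m"
    have hull_le: "convex hull V \<subseteq> benzel_hexagon a b \<longleftrightarrow> V \<subseteq> benzel_hexagon a b" for V
      by (rule subset_hull) (simp add: benzel_hexagon_def)
    have "grid_cell (m, n) \<subseteq> benzel_hexagon a b \<longleftrightarrow>
      1 - b \<le> y \<and> y \<le> a - 1 \<and> 1 - a \<le> x \<and> x \<le> b - 1 \<and> 1 - b \<le> x - y \<and> x - y \<le> a - 1"
      unfolding grid_cell_def center_eq_lattice_point cell_lattice_point hull_le
        x_def[symmetric] y_def[symmetric]
      by (auto simp: lattice_point_in_hexagon[OF ab] simp del: of_int_add of_int_diff)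
    then show ?thesis by (simp add: x_def y_def algebra_simps)
  qed
  show ?thesis
    by (simp add: indices_def in_benzel set_eq_iff in_hexagon)
qed

lemma finite_indices_benzel:
  assumes "a \<le> 2 * b" "b \<le> 2 * a"
  shows "finite (indices (benzel a b))"
proof (rule finite_subset)
  show "indices (benzel a b) \<subseteq> {- (a + b)..a + b} \<times> {- (a + b)..a + b}"
    unfolding indices_benzel[OF assms] by auto
qed simp

text \<open>Let \<open>h\<close> be one of the three bounded quantities at the vertex that the stone surrounds. On the
  three cells of the stone it takes the values \<open>h - 1\<close>, \<open>h\<close>, \<open>h + 1\<close>. One cell in the hexagon gives
  \<open>- b \<le> h \<le> a\<close>, and \<open>2 - b \<le> h \<le> a - 2\<close> is needed for all three; the residue of \<open>h\<close> closes this gap,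
  since both \<open>2 - b\<close> and \<open>a - 2\<close> are congruent to \<open>h\<close> modulo 3.\<close>
lemma aligned_stone_in_benzel:
  fixes a b :: int
  assumes ab: "a \<le> 2 * b" "b \<le> 2 * a" "(a + b) mod 3 = 1"
    and t: "t \<in> aligned_stones (b + 1)"
    and meets: "q \<in> indices t" "q \<in> indices (benzel a b)"
  shows "t \<subseteq> benzel a b"
proof -
  obtain m n where mn: "t = patch (right_shape (m, n))" "(m - n - (b + 1)) mod 3 = 0"
    using t by (auto simp: aligned_stones_def)
  have shrink: "2 - b \<le> h \<and> h \<le> a - 2" if "- b \<le> h" "h \<le> a" "(h + b) mod 3 = 2" for h
    using that ab(3) by presburger
  have "q = (m, n) \<or> q = (m - 1, n) \<or> q = (m, n - 1)"
    using meets(1) by (simp add: mn(1) right_shape_def)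
  then have weak: "- b \<le> n - m" "n - m \<le> a" "- b \<le> - (m + 2 * n)" "- (m + 2 * n) \<le> a"
    "- b \<le> 2 * m + n" "2 * m + n \<le> a"
    using meets(2) unfolding indices_benzel[OF ab(1,2)] by auto
  have residue: "(n - m + b) mod 3 = 2" "(- (m + 2 * n) + b) mod 3 = 2" "(2 * m + n + b) mod 3 = 2"
    using mn(2) by presburger+
  have "2 - b \<le> n - m \<and> n - m \<le> a - 2"
    "2 - b \<le> - (m + 2 * n) \<and> - (m + 2 * n) \<le> a - 2"
    "2 - b \<le> 2 * m + n \<and> 2 * m + n \<le> a - 2"
    by (rule shrink[OF weak(1,2) residue(1)] shrink[OF weak(3,4) residue(2)]
          shrink[OF weak(5,6) residue(3)])+
  then have "right_shape (m, n) \<subseteq> indices (benzel a b)"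
    unfolding indices_benzel[OF ab(1,2)] right_shape_def by auto
  then show ?thesis by (auto simp: mn(1) patch_def indices_def)
qed

theorem theorem1p1:
  fixes a b :: int
  assumes "2 \<le> a" "a \<le> 2 * b"
    and "2 \<le> b" "b \<le> 2 * a"
    and "(a + b) mod 3 = 1"
  shows "(\<exists>!T. stones_and_bones_tiling (benzel a b) T) \<and>
         (\<forall>T. stones_and_bones_tiling (benzel a b) T \<longrightarrow> T \<subseteq> right_stones)"
proof -
  define T0 where "T0 = {t \<in> aligned_stones (b + 1). t \<subseteq> benzel a b}"
  have "\<exists>!t. t \<in> T0 \<and> q \<in> indices t" if "q \<in> indices (benzel a b)" for q
    using aligned_stones_tile_plane[of "b + 1" q] aligned_stone_in_benzel[OF assms(2,4,5) _ _ that]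
    unfolding T0_def by blast
  then have tiling: "stones_and_bones_tiling (benzel a b) T0"
    using aligned_subset_right right_stones_subset
    unfolding tiling_iff_indices T0_def by blast
  have "T = T0" if "stones_and_bones_tiling (benzel a b) T" for T
    using aligned_tiling_unique[OF finite_indices_benzel[OF assms(2,4)] _ that, of "b + 1"] tiling
    unfolding T0_def .
  moreover have "T0 \<subseteq> right_stones"
    using aligned_subset_right by (auto simp: T0_def)
  ultimately show ?thesis using tiling by blast
qed

end
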